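(* Let $p$ be a prime and let $k,t$ be integers with $p>k\ge 3$ and $2\le t<\frac14\sqrt p$. Let $t'=t+\lfloor (k-1)/2\rfloor-1$. Then there exists a set $S\subseteq(\mathbb{Z}/p^k\mathbb{Z})^2$ of size $$|S|=2^{\left\lfloor\frac{k-1}{2}\right\rfloor}\left(\binom{t+1}{2}+1\right)-1$$ such that $S$ cannot be covered by $t'$ lines, but for every $x\in S$ the set $S\setminus\{x\}$ can be covered by $t'$ lines.
   Context: Write $\mathcal{R}=\mathbb{Z}/p^k\mathbb{Z}$. A line in $\mathcal{R}^2$ is a set of the form $L_b(a)=\{a+sb: s\in\mathcal{R}\}$, where $a\in\mathcal{R}^2$ and $b=(b_1,b_2)\in\mathcal{R}^2$ has at least one coordinate that is invertible in $\mathcal{R}$. A set is covered by $t'$ lines if it is contained in the union of some $t'$ lines. *)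

theory Defs
  imports Complex_Main "HOL-Number_Theory.Residues"
begin

definition line :: "('a, 'm) ring_scheme \<Rightarrow> 'a \<times> 'a \<Rightarrow> 'a \<times> 'a \<Rightarrow> ('a \<times> 'a) set" where
  "line R a b =
    {(fst a \<oplus>\<^bsub>R\<^esub> s \<otimes>\<^bsub>R\<^esub> fst b, snd a \<oplus>\<^bsub>R\<^esub> s \<otimes>\<^bsub>R\<^esub> snd b) | s. s \<in> carrier R}"

definition lines :: "('a, 'm) ring_scheme \<Rightarrow> ('a \<times> 'a) set set" where
  "lines R =
    {line R a b | a b. a \<in> carrier R \<times> carrier R \<and> b \<in> carrier R \<times> carrier R \<and>
      (fst b \<in> Units R \<or> snd b \<in> Units R)}"

(* Exactly n distinct lines; same as "at most n" as long as n is at most the number of lines. *)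
definition covered_by_lines :: "('a, 'm) ring_scheme \<Rightarrow> ('a \<times> 'a) set \<Rightarrow> nat \<Rightarrow> bool" where
  "covered_by_lines R S n \<longleftrightarrow>
    (\<exists>\<L>. \<L> \<subseteq> lines R \<and> finite \<L> \<and> card \<L> = n \<and> S \<subseteq> \<Union>\<L>)"

end

theory Submission
  imports Defs
begin

text \<open>
  Everything is done with integer points modulo \<open>p ^ k\<close> and nonvertical lines
  \<open>y \<equiv> m x + c\<close>, for point sets in which any two points differ by
  \<open>(p ^ i u, p ^ i w)\<close> with \<open>p\<close> not dividing \<open>u\<close> and \<open>i < k\<close>. Such a set is critical for \<open>n\<close> lines
  if \<open>n\<close> lines do not cover it, but cover it after the removal of any point. A
  (sheared) triangular grid is critical modulo every power of \<open>p\<close>.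

  If \<open>S\<close> is critical modulo \<open>p ^ k\<close> for \<open>n\<close> lines, replace each point \<open>(x, y)\<close> by the two points
  \<open>(x, p y)\<close> and \<open>(x + p ^ k, p y)\<close> and add one point \<open>(z, 1)\<close> where \<open>z\<close> is a new residue
  modulo \<open>p\<close>. The result is critical modulo \<open>p ^ (k + 1)\<close> for \<open>n + 1\<close> lines: the lines
  \<open>y = p m x + p c\<close> contain both lifts of a point or none and miss \<open>(z, 1)\<close>, while
  every other line contains at most one lifted point. Hence if \<open>h \<ge> 1\<close> of \<open>n + 1\<close> covering lines
  are of the second kind, the others leave at most \<open>h div 2\<close> points of \<open>S\<close> uncovered, and \<open>S\<close>
  is covered by \<open>n + 1 - h + h div 2 \<le> n\<close> lines.
\<close>

section \<open>Nonvertical lines and separated point sets over the integers\<close>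

definition on_line :: "int \<Rightarrow> int \<times> int \<Rightarrow> int \<times> int \<Rightarrow> bool" where
  "on_line M l P \<longleftrightarrow> M dvd snd P - fst l * fst P - snd l"

text \<open>Slopes and intercepts are unreduced integers, so distinct pairs may describe the same
  line modulo \<open>M\<close>. The bound "at most \<open>n\<close>" makes this harmless.\<close>

definition slope_covered :: "int \<Rightarrow> (int \<times> int) set \<Rightarrow> nat \<Rightarrow> bool" where
  "slope_covered M S n \<longleftrightarrow>
    (\<exists>L. finite L \<and> card L \<le> n \<and> (\<forall>P\<in>S. \<exists>l\<in>L. on_line M l P))"

text \<open>The exponent \<open>i\<close> is the exact \<open>p\<close>-adic valuation of the
  horizontal difference. The vertical difference has at least this valuation, so the slope joining
  the points is \<open>p\<close>-integral.\<close>

definition separated :: "int \<Rightarrow> nat \<Rightarrow> int \<times> int \<Rightarrow> int \<times> int \<Rightarrow> bool" where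
  "separated p k P Q \<longleftrightarrow>
    (\<exists>i<k. \<exists>u. fst P - fst Q = p ^ i * u \<and> \<not> p dvd u \<and> p ^ i dvd snd P - snd Q)"

definition critical :: "int \<Rightarrow> nat \<Rightarrow> nat \<Rightarrow> (int \<times> int) set \<Rightarrow> bool" where
  "critical p k n S \<longleftrightarrow> finite S \<and> pairwise (separated p k) S \<and>
    \<not> slope_covered (p ^ k) S n \<and> (\<forall>P\<in>S. slope_covered (p ^ k) (S - {P}) n)"

lemma slope_covered_mono:
  assumes "slope_covered M T n" "S \<subseteq> T" "n \<le> n'"
  shows "slope_covered M S n'"
proof -
  obtain L where "finite L" "card L \<le> n" "\<forall>P\<in>T. \<exists>l\<in>L. on_line M l P"
    using assms(1) unfolding slope_covered_def by blast
  then show ?thesis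
    using assms(2,3) unfolding slope_covered_def
    by (intro exI[of _ L]) (auto dest: subsetD)
qed

lemma slope_covered_Un:
  assumes "slope_covered M S m" "slope_covered M T n"
  shows "slope_covered M (S \<union> T) (m + n)"
proof -
  obtain K where K: "finite K" "card K \<le> m" "\<forall>P\<in>S. \<exists>l\<in>K. on_line M l P"
    using assms(1) unfolding slope_covered_def by blast
  obtain L where L: "finite L" "card L \<le> n" "\<forall>P\<in>T. \<exists>l\<in>L. on_line M l P"
    using assms(2) unfolding slope_covered_def by blast
  have "card (K \<union> L) \<le> m + n"
    using card_Un_le[of K L] K(2) L(2) by linarith
  then show ?thesis
    unfolding slope_covered_def using K L by (intro exI[of _ "K \<union> L"]) auto
qed

lemma slope_covered_card:
  assumes "finite S"
  shows "slope_covered M S (card S)"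
proof -
  have "\<exists>l\<in>(\<lambda>P. (0, snd P)) ` S. on_line M l P" if "P \<in> S" for P
    using that by (intro bexI[of _ "(0, snd P)"]) (auto simp: on_line_def)
  then show ?thesis
    unfolding slope_covered_def using assms card_image_le[OF assms, of "\<lambda>P. (0, snd P)"]
    by (intro exI[of _ "(\<lambda>P. (0, snd P)) ` S"]) auto
qed

lemma slope_covered_single:
  assumes "\<And>P. P \<in> S \<Longrightarrow> on_line M l P"
  shows "slope_covered M S 1"
  unfolding slope_covered_def using assms by (intro exI[of _ "{l}"]) auto

lemma separatedI:
  assumes "\<not> p dvd fst P - fst Q" "k > 0"
  shows "separated p k P Q"
  unfolding separated_def
  using assms by (intro exI[of _ "0 :: nat"] conjI exI[of _ "fst P - fst Q"]) simp_all

lemma prime_power_inverse: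
  fixes p u :: int
  assumes "prime p" "\<not> p dvd u"
  obtains v where "p ^ k dvd u * v - 1"
proof -
  have "coprime u (p ^ k)"
    using assms by (metis coprime_commute coprime_power_left_iff prime_imp_coprime)
  then obtain v where "[u * v = 1] (mod p ^ k)"
    using cong_solve_coprime_int by blast
  then show ?thesis using that by (simp add: cong_iff_dvd_diff)
qed

text \<open>Multiplying the equation by an inverse of \<open>a\<close> modulo \<open>p ^ k\<close>
  puts it into slope form. A single \<open>l\<close> serves all its integer solutions.\<close>

lemma on_line_of_unit:
  fixes p a b g :: int
  assumes "prime p" "\<not> p dvd a"
  obtains l where "\<And>P. a * snd P = b * fst P + g \<Longrightarrow> on_line (p ^ k) l P"
proof -
  obtain v where v: "p ^ k dvd a * v - 1" using prime_power_inverse assms by metis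
  have "on_line (p ^ k) (v * b, v * g) P" if "a * snd P = b * fst P + g" for P
  proof -
    have "snd P - (v * b) * fst P - v * g = snd P - v * (a * snd P)"
      using that by (simp add: algebra_simps)
    also have "\<dots> = - ((a * v - 1) * snd P)" by (simp add: algebra_simps)
    finally show ?thesis using v by (simp add: on_line_def)
  qed
  then show ?thesis using that by blast
qed

text \<open>Cancelling \<open>p ^ i\<close> from both differences leaves a direction
  \<open>(u, w)\<close> in which \<open>u\<close> is a unit.\<close>

lemma separated_line:
  assumes "prime p" "separated p k P Q"
  obtains l where "on_line (p ^ k) l P" "on_line (p ^ k) l Q"
proof -
  obtain i u w where u: "fst P - fst Q = p ^ i * u" "\<not> p dvd u"
    and w: "snd P - snd Q = p ^ i * w"
    using assms(2) unfolding separated_def dvd_def by metis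
  obtain l where l: "\<And>A. u * snd A = w * fst A + (u * snd Q - w * fst Q) \<Longrightarrow> on_line (p ^ k) l A"
    using on_line_of_unit[OF assms(1) u(2)] by metis
  have "u * (snd P - snd Q) = w * (fst P - fst Q)"
    unfolding u(1) w by simp
  then have "u * snd P = w * fst P + (u * snd Q - w * fst Q)"
    by (simp add: algebra_simps)
  then show ?thesis using l[of P] l[of Q] that by simp
qed

section \<open>The doubling step\<close>

definition lift :: "int \<Rightarrow> nat \<Rightarrow> int \<times> int \<times> int \<Rightarrow> int \<times> int" where
  "lift p k = (\<lambda>(e, x, y). (x + e * p ^ k, p * y))"

definition doubling :: "int \<Rightarrow> nat \<Rightarrow> int \<Rightarrow> (int \<times> int) set \<Rightarrow> (int \<times> int) set" where
  "doubling p k z S = insert (z, 1) (lift p k ` ({0, 1} \<times> S))"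

text \<open>Shifting \<open>x\<close> by \<open>e * p ^ k\<close> changes \<open>p * m * x\<close>
  by a multiple of \<open>p ^ Suc k\<close>, so \<open>e\<close> is irrelevant and one factor
  \<open>p\<close> cancels.\<close>

lemma on_line_lift:
  assumes "p \<noteq> 0"
  shows "on_line (p ^ Suc k) (p * m, p * c) (lift p k (e, P)) \<longleftrightarrow> on_line (p ^ k) (m, c) P"
proof -
  obtain x y where P: "P = (x, y)" by fastforce
  have "p * y - p * m * (x + e * p ^ k) - p * c = p * ((y - m * x - c) - p ^ k * (m * e))"
    by (simp add: algebra_simps)
  then have "on_line (p ^ Suc k) (p * m, p * c) (lift p k (e, P)) \<longleftrightarrow>
      p ^ k dvd (y - m * x - c) - p ^ k * (m * e)"
    using assms by (simp add: on_line_def lift_def P)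
  also have "\<dots> \<longleftrightarrow> p ^ k dvd y - m * x - c"
    by (metis dvd_diff_left_iff dvd_triv_left)
  finally show ?thesis by (simp add: on_line_def P)
qed

lemma slope_covered_lift:
  assumes "p \<noteq> 0" "slope_covered (p ^ k) S n"
  shows "slope_covered (p ^ Suc k) (lift p k ` (E \<times> S)) n"
proof -
  obtain L where L: "finite L" "card L \<le> n" "\<forall>P\<in>S. \<exists>l\<in>L. on_line (p ^ k) l P"
    using assms(2) unfolding slope_covered_def by blast
  let ?f = "\<lambda>l. (p * fst l, p * snd l)"
  have "\<exists>l\<in>?f ` L. on_line (p ^ Suc k) l (lift p k (e, P))" if P: "P \<in> S" for e P
  proof -
    obtain l where l: "l \<in> L" "on_line (p ^ k) l P" using P L(3) by blast
    then have "on_line (p ^ Suc k) (?f l) (lift p k (e, P))"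
      using on_line_lift[OF assms(1), of k "fst l" "snd l" e P] by simp
    then show ?thesis using l(1) by blast
  qed
  moreover have "card (?f ` L) \<le> n" using card_image_le[OF L(1), of ?f] L(2) by linarith
  ultimately show ?thesis
    unfolding slope_covered_def using L(1) by (intro exI[of _ "?f ` L"]) auto
qed

text \<open>For two lifts of one point take \<open>i = k\<close>. For lifts of different points the
  horizontal valuation stays that of \<open>P\<close> and \<open>Q\<close>, while the vertical
  difference gains a factor \<open>p\<close>. The resulting \<open>p ^ Suc i\<close>, stronger than
  separation, is what restricts steep lines.\<close>

lemma lift_diff:
  assumes "prime p" "pairwise (separated p k) S"
    and "P \<in> S" "Q \<in> S" "e \<in> {0, 1}" "f \<in> {0, 1}" "(e, P) \<noteq> (f, Q)"
  obtains i u where "i < Suc k" "fst (lift p k (e, P)) - fst (lift p k (f, Q)) = p ^ i * u"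
    "\<not> p dvd u" "p ^ Suc i dvd snd (lift p k (e, P)) - snd (lift p k (f, Q))"
proof (cases "P = Q")
  case True
  then have "\<not> p dvd e - f"
    using assms by (auto simp: not_prime_unit)
  moreover have "fst (lift p k (e, P)) - fst (lift p k (f, Q)) = p ^ k * (e - f)"
    "snd (lift p k (e, P)) - snd (lift p k (f, Q)) = 0"
    using True by (auto simp: lift_def algebra_simps split: prod.split)
  ultimately show ?thesis using that[of k "e - f"] by simp
next
  case False
  then have "separated p k P Q" using assms unfolding pairwise_def by blast
  then obtain i u where i: "i < k" and u: "fst P - fst Q = p ^ i * u" "\<not> p dvd u"
    and w: "p ^ i dvd snd P - snd Q"
    unfolding separated_def by blast
  have k: "p ^ k = p ^ i * p ^ (k - i)" using i by (simp flip: power_add)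
  have pk: "p dvd p ^ (k - i)" using i by simp
  have "fst (lift p k (e, P)) - fst (lift p k (f, Q)) = (fst P - fst Q) + (e - f) * p ^ k"
    by (auto simp: lift_def algebra_simps split: prod.split)
  also have "\<dots> = p ^ i * (u + (e - f) * p ^ (k - i))"
    unfolding u(1) k by (simp add: algebra_simps)
  finally have 1: "fst (lift p k (e, P)) - fst (lift p k (f, Q)) = p ^ i * (u + (e - f) * p ^ (k - i))" .
  have 2: "\<not> p dvd u + (e - f) * p ^ (k - i)"
    using u(2) pk by (simp add: dvd_add_left_iff)
  have "snd (lift p k (e, P)) - snd (lift p k (f, Q)) = p * (snd P - snd Q)"
    by (auto simp: lift_def algebra_simps split: prod.split)
  then have 3: "p ^ Suc i dvd snd (lift p k (e, P)) - snd (lift p k (f, Q))"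
    using w by simp
  show ?thesis using that[OF _ 1 2 3] i by simp
qed

lemma inj_on_lift:
  assumes "prime p" "pairwise (separated p k) S"
  shows "inj_on (lift p k) ({0, 1} \<times> S)"
proof (rule inj_onI, clarsimp simp del: insert_iff)
  fix e x y f x' y'
  assume *: "e \<in> {0, 1}" "f \<in> {0, 1}" "(x, y) \<in> S" "(x', y') \<in> S"
    "lift p k (e, x, y) = lift p k (f, x', y')"
  show "e = f \<and> x = x' \<and> y = y'"
  proof (rule ccontr)
    assume "\<not> (e = f \<and> x = x' \<and> y = y')"
    then have "(e, (x, y)) \<noteq> (f, (x', y'))" by simp
    from lift_diff[OF assms *(3,4,1,2) this] obtain i u where
      "fst (lift p k (e, x, y)) - fst (lift p k (f, x', y')) = p ^ i * u" "\<not> p dvd u"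
      by metis
    then show False using *(5) assms(1) by simp
  qed
qed

text \<open>Subtracting the incidences of two different lifts forces \<open>p\<close> to divide the
  slope. Since lifts have second coordinate divisible by \<open>p\<close>, it then divides the
  intercept as well.\<close>

lemma steep_line_lift:
  assumes "prime p" "pairwise (separated p k) S"
    and "P \<in> S" "Q \<in> S" "e \<in> {0, 1}" "f \<in> {0, 1}"
    and on: "on_line (p ^ Suc k) l (lift p k (e, P))" "on_line (p ^ Suc k) l (lift p k (f, Q))"
    and steep: "\<not> (p dvd fst l \<and> p dvd snd l)"
  shows "(e, P) = (f, Q)"
proof (rule ccontr)
  assume ne: "(e, P) \<noteq> (f, Q)"
  define A where "A = lift p k (e, P)"
  define B where "B = lift p k (f, Q)"
  obtain i u where i: "i < Suc k" and u: "fst A - fst B = p ^ i * u" "\<not> p dvd u"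
    and w: "p ^ Suc i dvd snd A - snd B"
    unfolding A_def B_def using lift_diff[OF assms(1-6) ne] by metis
  have "p ^ Suc k dvd (snd A - fst l * fst A - snd l) - (snd B - fst l * fst B - snd l)"
    using on unfolding on_line_def A_def B_def by (rule dvd_diff)
  then have "p ^ Suc i dvd (snd A - fst l * fst A - snd l) - (snd B - fst l * fst B - snd l)"
    using i by (meson dvd_trans le_imp_power_dvd Suc_leI)
  moreover have "(snd A - fst l * fst A - snd l) - (snd B - fst l * fst B - snd l)
      = (snd A - snd B) - p ^ i * (fst l * u)"
    using u(1) by (simp add: algebra_simps flip: right_diff_distrib)
  ultimately have "p ^ Suc i dvd p ^ i * (fst l * u)"
    using w by (metis dvd_diff_right_iff)
  then have "p dvd fst l * u" using assms(1) by (auto simp: mult.commute[of p])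
  then have 1: "p dvd fst l" using u(2) assms(1) by (simp add: prime_dvd_mult_iff)
  have "p dvd snd A - fst l * fst A - snd l"
    using on(1) unfolding on_line_def A_def
    by (meson dvd_trans dvd_power zero_less_Suc)
  moreover have "p dvd snd A" unfolding A_def lift_def by (simp split: prod.split)
  ultimately have "p dvd snd l"
    using 1 by (metis dvd_diff dvd_diff_right_iff dvd_mult2)
  then show False using 1 steep by simp
qed

lemma doubling_not_covered:
  assumes "prime p" "finite S" "pairwise (separated p k) S"
    and not: "\<not> slope_covered (p ^ k) S n"
  shows "\<not> slope_covered (p ^ Suc k) (doubling p k z S) (Suc n)"
proof
  assume "slope_covered (p ^ Suc k) (doubling p k z S) (Suc n)"
  then obtain L where L: "finite L" "card L \<le> Suc n"
    and cov: "\<And>P. P \<in> doubling p k z S \<Longrightarrow> \<exists>l\<in>L. on_line (p ^ Suc k) l P"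
    unfolding slope_covered_def by blast
  have p0: "p \<noteq> 0" using assms(1) by auto
  \<comment> \<open>\<open>G\<close> holds the lines that come from lines modulo
    \<open>p ^ k\<close>, and \<open>N\<close> the steep ones. The point \<open>(z, 1)\<close> makes
    \<open>N\<close> nonempty, because a line of \<open>G\<close> through it would give
    \<open>p dvd 1\<close>.\<close>
  define G where "G = {l \<in> L. p dvd fst l \<and> p dvd snd l}"
  define N where "N = L - G"
  have fin: "finite G" "finite N" using L(1) by (auto simp: G_def N_def)
  have LGN: "card L = card G + card N"
    unfolding N_def using L(1) by (metis (no_types, lifting) G_def Diff_cancel card_Diff_subset card_mono fin(1) le_add_diff_inverse mem_Collect_eq subsetI)
  obtain l0 where l0: "l0 \<in> L" "on_line (p ^ Suc k) l0 (z, 1)"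
    using cov[of "(z, 1)"] by (auto simp: doubling_def)
  have "l0 \<notin> G"
  proof
    assume "l0 \<in> G"
    then have d: "p dvd fst l0" "p dvd snd l0" by (auto simp: G_def)
    have "p dvd 1 - fst l0 * z - snd l0"
      using l0(2) unfolding on_line_def by (auto intro: dvd_mult_left)
    moreover have "p dvd fst l0 * z" using d by simp
    ultimately have "p dvd 1" using d(2) by (metis dvd_diff_left_iff)
    then show False using assms(1) by (simp add: not_prime_unit)
  qed
  then have N1: "card N \<ge> 1"
    using l0(1) fin(2) by (metis N_def DiffI One_nat_def Suc_leI card_gt_0_iff empty_iff)
  define G' where "G' = (\<lambda>l. (fst l div p, snd l div p)) ` G"
  define U where "U = {P \<in> S. \<forall>l\<in>G'. \<not> on_line (p ^ k) l P}"
  have finU: "finite U" using assms(2) by (simp add: U_def)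
  \<comment> \<open>Both lifts of a point of \<open>U\<close> need steep lines, and no steep line
    serves two lifts, whence \<open>2 * card U \<le> card N\<close>.\<close>
  have "\<exists>l\<in>N. on_line (p ^ Suc k) l (lift p k a)" if a: "a \<in> {0, 1} \<times> U" for a
  proof -
    obtain e P where a': "a = (e, P)" "e \<in> {0, 1}" "P \<in> U" using a by blast
    then have "lift p k a \<in> doubling p k z S" by (auto simp: doubling_def U_def)
    then obtain l where l: "l \<in> L" "on_line (p ^ Suc k) l (lift p k a)" using cov by blast
    have "l \<notin> G"
    proof
      assume lG: "l \<in> G"
      then have "l = (p * (fst l div p), p * (snd l div p))" by (auto simp: G_def)
      then have "on_line (p ^ k) (fst l div p, snd l div p) P"
        using l(2) on_line_lift[OF p0] a'(1) by metis
      then show False using a'(3) lG by (auto simp: U_def G'_def)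
    qed
    then show ?thesis using l by (auto simp: N_def)
  qed
  then obtain h where h: "\<And>a. a \<in> {0, 1} \<times> U \<Longrightarrow> h a \<in> N \<and> on_line (p ^ Suc k) (h a) (lift p k a)"
    by metis
  have "inj_on h ({0, 1} \<times> U)"
  proof (rule inj_onI)
    fix a b assume ab: "a \<in> {0, 1} \<times> U" "b \<in> {0, 1} \<times> U" "h a = h b"
    obtain e P where a: "a = (e, P)" "e \<in> {0, 1}" "P \<in> S" using ab(1) by (auto simp: U_def)
    obtain f Q where b: "b = (f, Q)" "f \<in> {0, 1}" "Q \<in> S" using ab(2) by (auto simp: U_def)
    have "\<not> (p dvd fst (h a) \<and> p dvd snd (h a))"
      using h[OF ab(1)] by (auto simp: N_def G_def)
    then have "(e, P) = (f, Q)"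
      using steep_line_lift[OF assms(1,3) a(3) b(3) a(2) b(2)] h[OF ab(1)] h[OF ab(2)] ab(3) a(1) b(1)
      by metis
    then show "a = b" using a b by simp
  qed
  moreover have "h ` ({0, 1} \<times> U) \<subseteq> N" using h by blast
  ultimately have "card ({0, 1 :: int} \<times> U) \<le> card N" using card_inj_on_le fin(2) by blast
  then have U2: "2 * card U \<le> card N" by (simp add: card_cartesian_product)
  have "slope_covered (p ^ k) (S - U) (card G)"
    unfolding slope_covered_def
    using fin(1) card_image_le[OF fin(1), of "\<lambda>l. (fst l div p, snd l div p)"]
    by (intro exI[of _ G']) (auto simp: G'_def U_def)
  \<comment> \<open>From \<open>card N \<ge> 1\<close> and \<open>2 * card U \<le> card N\<close>
    follows \<open>card U \<le> card N - 1\<close>, so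
    \<open>card G + card U \<le> n\<close>.\<close>
  from slope_covered_Un[OF this slope_covered_card[OF finU]]
  have "slope_covered (p ^ k) S n"
    by (rule slope_covered_mono) (use U2 N1 LGN L(2) in auto)
  then show False using not by simp
qed

lemma doubling_separated:
  assumes "prime p" "pairwise (separated p k) S" "\<And>P. P \<in> S \<Longrightarrow> \<not> p dvd fst P - z" "k > 0"
  shows "pairwise (separated p (Suc k)) (doubling p k z S)"
proof -
  have z: "\<not> p dvd fst (lift p k (e, P)) - z" if "P \<in> S" for e P
  proof -
    have "fst (lift p k (e, P)) - z = (fst P - z) + e * p ^ k"
      by (simp add: lift_def split: prod.split)
    moreover have "p dvd e * p ^ k" using assms(4) by simp
    ultimately show ?thesis using assms(3)[OF that] by (metis dvd_add_left_iff)
  qed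
  have sz: "separated p (Suc k) (lift p k (e, P)) (z, 1)"
    "separated p (Suc k) (z, 1) (lift p k (e, P))" if "P \<in> S" for e P
    using z[OF that, of e] by (auto intro!: separatedI simp: dvd_diff_commute)
  have ss: "separated p (Suc k) (lift p k (e, P)) (lift p k (f, Q))"
    if *: "P \<in> S" "Q \<in> S" "e \<in> {0, 1}" "f \<in> {0, 1}" and ne: "(e, P) \<noteq> (f, Q)" for e f P Q
    using lift_diff[OF assms(1,2) * ne] unfolding separated_def
    by (metis dvd_trans le_imp_power_dvd le_SucI order_refl)
  show ?thesis
    unfolding pairwise_def
  proof (intro ballI impI)
    fix A B assume A: "A \<in> doubling p k z S" and B: "B \<in> doubling p k z S" and ne: "A \<noteq> B"
    consider "A = (z, 1)" | e P where "A = lift p k (e, P)" "e \<in> {0, 1}" "P \<in> S"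
      using A unfolding doubling_def by blast
    then show "separated p (Suc k) A B"
    proof cases
      case 1
      then obtain f Q where "B = lift p k (f, Q)" "Q \<in> S"
        using B ne unfolding doubling_def by blast
      then show ?thesis using 1 sz by simp
    next
      case (2 e P)
      consider "B = (z, 1)" | f Q where "B = lift p k (f, Q)" "f \<in> {0, 1}" "Q \<in> S"
        using B unfolding doubling_def by blast
      then show ?thesis
      proof cases
        case 1 then show ?thesis using 2 sz by simp
      next
        case (2 f Q)
        then show ?thesis using ss \<open>A = _\<close> \<open>e \<in> _\<close> \<open>P \<in> S\<close> ne by metis
      qed
    qed
  qed
qed

text \<open>After a deletion, choose \<open>P\<close> so that at most two remaining points are not
  lifts of \<open>S - {P}\<close>. The lifts of \<open>S - {P}\<close> need \<open>n\<close> lines,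
  and one more line joins those two points by separatedness.\<close>

lemma critical_doubling:
  assumes "prime p" "critical p k n S" "\<And>P. P \<in> S \<Longrightarrow> \<not> p dvd fst P - z" "k > 0"
  shows "critical p (Suc k) (Suc n) (doubling p k z S)"
proof -
  have S: "finite S" "pairwise (separated p k) S" "\<not> slope_covered (p ^ k) S n"
    and crit: "\<And>P. P \<in> S \<Longrightarrow> slope_covered (p ^ k) (S - {P}) n"
    using assms(2) unfolding critical_def by auto
  have p0: "p \<noteq> 0" using assms(1) by auto
  note sep = doubling_separated[OF assms(1) S(2) assms(3,4)]
  have pair: "slope_covered (p ^ Suc k) {A, B} 1"
    if AB: "A \<in> doubling p k z S" "B \<in> doubling p k z S" for A B
  proof (cases "A = B")
    case True
    then show ?thesis using slope_covered_card[of "{A}" "p ^ Suc k"] by simp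
  next
    case False
    then have "separated p (Suc k) A B" using sep AB unfolding pairwise_def by blast
    then show ?thesis
      using separated_line[OF assms(1)] slope_covered_single[of "{A, B}"] by (metis insertE singletonD)
  qed
  have key: "slope_covered (p ^ Suc k) (lift p k ` ({0, 1} \<times> (S - {P})) \<union> {A, B}) (Suc n)"
    if "P \<in> S" "A \<in> doubling p k z S" "B \<in> doubling p k z S" for P A B
    using slope_covered_Un[OF slope_covered_lift[OF p0 crit[OF that(1)]] pair[OF that(2,3)]] by simp
  have "slope_covered (p ^ Suc k) (doubling p k z S - {A}) (Suc n)" if A: "A \<in> doubling p k z S" for A
  proof -
    have mem: "(z, 1) \<in> doubling p k z S" "\<And>e P. e \<in> {0, 1} \<Longrightarrow> P \<in> S \<Longrightarrow> lift p k (e, P) \<in> doubling p k z S"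
      by (auto simp: doubling_def)
    consider "A = (z, 1)" | e P where "A = lift p k (e, P)" "e \<in> {0, 1}" "P \<in> S"
      using A unfolding doubling_def by blast
    then show ?thesis
    proof cases
      case 1
      \<comment> \<open>Deleting \<open>(z, 1)\<close> leaves only lifts, so \<open>P\<close> may be
        any point of \<open>S\<close>; one must exist, as the empty set is covered.\<close>
      have "slope_covered (p ^ k) {} n"
        by (rule slope_covered_mono[OF slope_covered_card[of "{}"]]) auto
      then have "S \<noteq> {}" using S(3) by auto
      then obtain P where P: "P \<in> S" by blast
      show ?thesis
        by (rule slope_covered_mono[OF key[OF P mem(2)[of 0 P] mem(2)[of 1 P]]])
          (use 1 P in \<open>auto simp: doubling_def\<close>)
    next
      case (2 e P)
      have "1 - e \<in> {0, 1}" using 2(2) by auto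
      then show ?thesis
        by (intro slope_covered_mono[OF key[OF 2(3) mem(1) mem(2)[of "1 - e" P]]])
          (use 2 in \<open>auto simp: doubling_def\<close>)
    qed
  qed
  moreover have "finite (doubling p k z S)" using S(1) by (simp add: doubling_def)
  ultimately show ?thesis
    unfolding critical_def using sep doubling_not_covered[OF assms(1) S] by blast
qed

lemma card_doubling:
  assumes "prime p" "critical p k n S"
  shows "card (doubling p k z S) = 2 * card S + 1"
proof -
  have S: "finite S" "pairwise (separated p k) S" using assms(2) unfolding critical_def by auto
  have "(z, 1) \<notin> lift p k ` ({0, 1} \<times> S)"
  proof
    assume "(z, 1) \<in> lift p k ` ({0, 1} \<times> S)"
    then obtain y where "p * y = 1" by (auto simp: lift_def)
    then have "p dvd 1" by (metis dvd_triv_left)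
    then show False using assms(1) by (simp add: not_prime_unit)
  qed
  moreover have "card (lift p k ` ({0, 1} \<times> S)) = 2 * card S"
    using card_image[OF inj_on_lift[OF assms(1) S(2)]] by (simp add: card_cartesian_product)
  ultimately show ?thesis using S(1) by (simp add: doubling_def)
qed

text \<open>Lifting preserves first coordinates modulo \<open>p\<close>, so a doubling uses up at
  most one new residue.\<close>

lemma fst_mod_doubling:
  assumes "k > 0"
  shows "(\<lambda>P. fst P mod p) ` doubling p k z S \<subseteq> insert (z mod p) ((\<lambda>P. fst P mod p) ` S)"
proof
  fix r assume "r \<in> (\<lambda>P. fst P mod p) ` doubling p k z S"
  then obtain A where A: "A \<in> doubling p k z S" "r = fst A mod p" by blast
  then consider "A = (z, 1)" | e P where "A = lift p k (e, P)" "P \<in> S"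
    unfolding doubling_def by blast
  then show "r \<in> insert (z mod p) ((\<lambda>P. fst P mod p) ` S)"
  proof cases
    case (2 e P)
    have "fst A - fst P = e * p ^ k" unfolding 2(1) by (simp add: lift_def split: prod.split)
    then have "fst A mod p = fst P mod p" using assms by (simp add: mod_eq_dvd_iff)
    then show ?thesis using 2(2) A(2) by blast
  qed (use A in simp)
qed

text \<open>The number of residues is tracked alongside the size: the size roughly doubles, but the
  residues grow by at most one per step, so a fresh \<open>z\<close> always remains. The recurrence
  \<open>2 * card T + 1\<close> becomes pure doubling for \<open>card T + 1\<close>.\<close>

lemma critical_iterate:
  assumes "prime p" "critical p k n S" "k > 0" "card S + m \<le> nat p"
  shows "\<exists>T. critical p (k + m) (n + m) T \<and> card T + 1 = 2 ^ m * (card S + 1) \<and>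
    card ((\<lambda>P. fst P mod p) ` T) \<le> card S + m"
  using assms(4)
proof (induction m)
  case 0
  have "finite S" using assms(2) by (simp add: critical_def)
  then show ?case using assms(2) card_image_le by (intro exI[of _ S]) auto
next
  case (Suc m)
  then obtain T where T: "critical p (k + m) (n + m) T" "card T + 1 = 2 ^ m * (card S + 1)"
    "card ((\<lambda>P. fst P mod p) ` T) \<le> card S + m" by auto
  have p: "p > 0" using assms(1) by (simp add: prime_gt_0_int)
  have finT: "finite T" using T(1) by (simp add: critical_def)
  let ?I = "(\<lambda>P. fst P mod p) ` T"
  have "card ?I < card {0..<p}" using T(3) Suc.prems by simp
  then have "\<not> {0..<p} \<subseteq> ?I" using card_mono[of ?I "{0..<p}"] finT by fastforce
  then obtain z where z: "z \<in> {0..<p}" "z \<notin> ?I" by blast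
  have zP: "\<not> p dvd fst P - z" if "P \<in> T" for P
  proof
    assume "p dvd fst P - z"
    then have "fst P mod p = z mod p" by (simp add: mod_eq_dvd_iff)
    then show False using z that by (auto simp: image_iff)
  qed
  let ?D = "doubling p (k + m) z T"
  have km: "k + m > 0" using assms(3) by simp
  have "card ((\<lambda>P. fst P mod p) ` ?D) \<le> card (insert (z mod p) ?I)"
    using fst_mod_doubling[OF km] finT by (intro card_mono) auto
  also have "\<dots> \<le> Suc (card ?I)" by (simp add: card_insert_if finT)
  finally have "card ((\<lambda>P. fst P mod p) ` ?D) \<le> card S + Suc m" using T(3) by simp
  moreover have "card ?D + 1 = 2 ^ Suc m * (card S + 1)"
    using card_doubling[OF assms(1) T(1)] T(2) by simp
  ultimately show ?case
    using critical_doubling[OF assms(1) T(1) zP km] by (intro exI[of _ ?D]) simp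
qed

section \<open>The triangular grid\<close>

text \<open>The shear makes the first coordinates distinct modulo \<open>p\<close>.\<close>

definition triangle :: "nat \<Rightarrow> nat \<Rightarrow> (int \<times> int) set" where
  "triangle t n = (\<lambda>(i, j). (int i + int t * int j, int j)) ` {(i, j). i + j \<le> n}"

lemma finite_grid: "finite {(i :: nat, j). i + j \<le> n}"
  by (rule finite_subset[of _ "{..n} \<times> {..n}"]) auto

lemma card_grid: "card {(i :: nat, j). i + j \<le> n} = (n + 2) choose 2"
proof (induction n)
  case 0
  have "{(i :: nat, j). i + j \<le> 0} = {(0, 0)}" by auto
  then show ?case by (simp add: numeral_2_eq_2)
next
  case (Suc n)
  have eq: "{(i :: nat, j). i + j \<le> Suc n} = {(i, j). i + j \<le> n} \<union> (\<lambda>i. (i, Suc n - i)) ` {..Suc n}"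
    by (auto simp: image_iff)
  have "card ((\<lambda>i. (i, Suc n - i)) ` {..Suc n}) = n + 2"
    by (subst card_image) (auto simp: inj_on_def)
  moreover have "{(i :: nat, j). i + j \<le> n} \<inter> (\<lambda>i. (i, Suc n - i)) ` {..Suc n} = {}" by auto
  ultimately have "card {(i :: nat, j). i + j \<le> Suc n} = ((n + 2) choose 2) + (n + 2)"
    unfolding eq using card_Un_disjoint[OF finite_grid] Suc.IH by simp
  also have "\<dots> = (Suc n + 2) choose 2" by (simp add: numeral_2_eq_2)
  finally show ?case .
qed

lemma not_dvd_small:
  fixes p d :: int
  assumes "d \<noteq> 0" "\<bar>d\<bar> < p"
  shows "\<not> p dvd d"
  using assms zdvd_not_zless[of "\<bar>d\<bar>" p] by auto

text \<open>The \<open>n + 2\<close> points with \<open>i + j = n + 1\<close> force one of \<open>n + 1\<close> lines to contain two of them; this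
  line is disjoint from the smaller triangle and can be dropped.\<close>

lemma triangle_not_covered:
  assumes "prime p" "int n < p"
  shows "\<not> slope_covered p (triangle t n) n"
  using assms(2)
proof (induction n)
  case 0
  have "triangle t 0 \<noteq> {}" by (auto simp: triangle_def)
  then show ?case by (auto simp: slope_covered_def)
next
  case (Suc n)
  show ?case
  proof
    assume "slope_covered p (triangle t (Suc n)) (Suc n)"
    then obtain L where L: "finite L" "card L \<le> Suc n"
      and cov: "\<And>P. P \<in> triangle t (Suc n) \<Longrightarrow> \<exists>l\<in>L. on_line p l P"
      unfolding slope_covered_def by blast
    \<comment> \<open>The sheared grid point \<open>(a - j, j)\<close>, indexed by its antidiagonal
      \<open>a\<close>. In these coordinates the line equation splits into a term in
      \<open>j\<close> and a term in \<open>a\<close>.\<close>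
    define P where "P a j = (int a - int j + int t * int j, int j)" for a j :: nat
    have P_in: "P a j \<in> triangle t b" if "j \<le> a" "a \<le> b" for a b j
      unfolding triangle_def using that by (intro image_eqI[of _ _ "(a - j, j)"]) (auto simp: P_def)
    have P_ex: "\<exists>a j. A = P a j \<and> j \<le> a \<and> a \<le> n" if "A \<in> triangle t n" for A
      using that by (force simp: triangle_def P_def intro: exI[of _ "_ + _"])
    have "\<forall>j\<in>{..Suc n}. \<exists>l\<in>L. on_line p l (P (Suc n) j)"
      using cov P_in by simp
    then obtain h where h: "\<And>j. j \<in> {..Suc n} \<Longrightarrow> h j \<in> L \<and> on_line p (h j) (P (Suc n) j)"
      by metis
    have "\<not> inj_on h {..Suc n}"
      using card_inj_on_le[of h "{..Suc n}" L] h L by fastforce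
    then obtain i j where ij: "i \<le> Suc n" "j \<le> Suc n" "i \<noteq> j" "h i = h j"
      unfolding inj_on_def by auto
    obtain m c where mc: "h i = (m, c)" by fastforce
    have lin: "snd (P a j) - m * fst (P a j) - c = int j * (1 - m * (int t - 1)) - m * int a - c" for a j
      by (simp add: P_def algebra_simps)
    have on: "on_line p (m, c) (P (Suc n) i)" "on_line p (m, c) (P (Suc n) j)"
      using h[of i] h[of j] ij mc by auto
    \<comment> \<open>Two points on one antidiagonal force the line to have the antidiagonal
      direction, that is, \<open>m * (int t - 1)\<close> is 1 modulo \<open>p\<close>.\<close>
    have "p dvd (int i - int j) * (1 - m * (int t - 1))"
      using dvd_diff[OF on[unfolded on_line_def fst_conv snd_conv lin]] by (simp add: algebra_simps)
    moreover have "\<not> p dvd int i - int j"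
      using ij Suc.prems by (intro not_dvd_small) auto
    ultimately have slope: "p dvd 1 - m * (int t - 1)"
      using assms(1) by (simp add: prime_dvd_mult_iff)
    have m: "\<not> p dvd m"
    proof
      assume "p dvd m"
      then have "p dvd 1" using slope by (metis dvd_diff_left_iff dvd_mult2)
      then show False using assms(1) by (simp add: not_prime_unit)
    qed
    \<comment> \<open>With this slope the line equation depends on \<open>a\<close> only, and
      antidiagonals \<open>a\<close> and \<open>Suc n\<close> differ by less than
      \<open>p\<close>.\<close>
    have off: "\<not> on_line p (m, c) (P a j')" if "a \<le> n" for a j'
    proof
      assume "on_line p (m, c) (P a j')"
      from dvd_diff[OF this[unfolded on_line_def fst_conv snd_conv lin]
          on(1)[unfolded on_line_def fst_conv snd_conv lin]]
      have "p dvd (int j' - int i) * (1 - m * (int t - 1)) + m * (int (Suc n) - int a)"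
        by (simp add: algebra_simps)
      then have "p dvd m * (int (Suc n) - int a)"
        using slope by (metis dvd_add_right_iff dvd_mult)
      then have "p dvd int (Suc n) - int a" using m assms(1) by (simp add: prime_dvd_mult_iff)
      moreover have "\<not> p dvd int (Suc n) - int a"
        using that Suc.prems by (intro not_dvd_small) auto
      ultimately show False by simp
    qed
    have mcL: "(m, c) \<in> L" using h[of i] ij mc by auto
    have "\<exists>l\<in>L - {(m, c)}. on_line p l A" if A: "A \<in> triangle t n" for A
    proof -
      obtain a j' where a: "A = P a j'" "j' \<le> a" "a \<le> n" using P_ex[OF A] by blast
      then obtain l where l: "l \<in> L" "on_line p l A" using cov P_in[of j' a "Suc n"] by (metis le_SucI)
      then have "l \<noteq> (m, c)" using off[OF a(3)] a(1) by auto
      then show ?thesis using l by blast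
    qed
    moreover have "card (L - {(m, c)}) \<le> n" using L mcL by simp
    ultimately have "slope_covered p (triangle t n) n"
      unfolding slope_covered_def using L(1) by (intro exI[of _ "L - {(m, c)}"]) auto
    then show False using Suc by simp
  qed
qed

text \<open>The first coordinate \<open>i + t * j\<close> is a base-\<open>t\<close> expansion with
  digits below \<open>t\<close>. Its values are distinct and below \<open>t * t < p\<close>, so
  separation holds with exponent 0.\<close>

lemma triangle_facts:
  assumes "prime p" "int t * int t < p" "k > 0" "n < t"
  shows "pairwise (separated p k) (triangle t n)" "card (triangle t n) = (n + 2) choose 2"
proof -
  have key: "\<not> p dvd (int i + int t * int j) - (int i' + int t * int j')"
    if "(i, j) \<noteq> (i', j')" "i + j \<le> n" "i' + j' \<le> n" for i j i' j' :: nat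
  proof (rule not_dvd_small)
    have b: "int i + int t * int j < int t * int t" if "i + j \<le> n" for i j
    proof -
      have "j + 1 \<le> t" using that assms(4) by simp
      have "i + t * j \<le> n - j + t * j" using that by simp
      also have "\<dots> < t + t * j" using assms(4) by simp
      also have "\<dots> = t * (j + 1)" by simp
      also have "\<dots> \<le> t * t" using \<open>j + 1 \<le> t\<close> by (rule mult_le_mono2)
      finally have "i + t * j < t * t" .
      then show ?thesis by (metis of_nat_add of_nat_less_iff of_nat_mult)
    qed
    have nn: "0 \<le> int i + int t * int j" "0 \<le> int i' + int t * int j'" by auto
    show "\<bar>(int i + int t * int j) - (int i' + int t * int j')\<bar> < p"
      using b[OF that(2)] b[OF that(3)] assms(2) nn by linarith
    show "(int i + int t * int j) - (int i' + int t * int j') \<noteq> 0"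
    proof
      assume "(int i + int t * int j) - (int i' + int t * int j') = 0"
      then have e: "i + t * j = i' + t * j'" by (metis eq_iff_diff_eq_0 of_nat_add of_nat_eq_iff of_nat_mult)
      have lt: "i < t" "i' < t" using that assms(4) by auto
      have "i = (i + t * j) mod t" "i' = (i' + t * j') mod t" using lt by auto
      then have "i = i'" using e by simp
      then show False using e that(1) lt by simp
    qed
  qed
  show "pairwise (separated p k) (triangle t n)"
    unfolding pairwise_def
  proof (intro ballI impI)
    fix A B assume A: "A \<in> triangle t n" and B: "B \<in> triangle t n" and ne: "A \<noteq> B"
    obtain i j where ij: "A = (int i + int t * int j, int j)" "i + j \<le> n"
      using A by (auto simp: triangle_def)
    obtain i' j' where ij': "B = (int i' + int t * int j', int j')" "i' + j' \<le> n"
      using B by (auto simp: triangle_def)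
    have "(i, j) \<noteq> (i', j')" using ne ij ij' by auto
    then have "\<not> p dvd fst A - fst B" using key ij ij' by simp
    then show "separated p k A B" using assms(3) by (rule separatedI)
  qed
  have "inj_on (\<lambda>(i, j). (int i + int t * int j, int j)) {(i, j). i + j \<le> n}"
    by (auto simp: inj_on_def)
  then show "card (triangle t n) = (n + 2) choose 2"
    unfolding triangle_def by (simp add: card_image card_grid)
qed

text \<open>Noncoverage descends from \<open>p ^ k\<close> to \<open>p\<close>. After the shear,
  columns and antidiagonals have slopes \<open>1 / t\<close> and \<open>1 / (t - 1)\<close>, which
  exist because both denominators are units modulo \<open>p\<close>.\<close>

lemma critical_triangle:
  assumes "prime p" "int t * int t < p" "k > 0" "2 \<le> t"
  shows "critical p k (t - 1) (triangle t (t - 1))"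
proof -
  have tp: "int t < p"
  proof -
    have "int t * 1 \<le> int t * int t" using assms(4) by (intro mult_left_mono) auto
    then show ?thesis using assms(2) by linarith
  qed
  have nt: "\<not> p dvd int t" "\<not> p dvd int t - 1"
    using tp assms(4) not_dvd_small[of "int t" p] not_dvd_small[of "int t - 1" p] by auto
  have nc: "\<not> slope_covered (p ^ k) (triangle t (t - 1)) (t - 1)"
  proof
    assume "slope_covered (p ^ k) (triangle t (t - 1)) (t - 1)"
    moreover have "on_line p l P" if "on_line (p ^ k) l P" for l P
      using that assms(3) unfolding on_line_def by (meson dvd_power dvd_trans)
    ultimately have "slope_covered p (triangle t (t - 1)) (t - 1)"
      unfolding slope_covered_def by metis
    then show False using triangle_not_covered[OF assms(1)] tp assms(4) by simp
  qed
  have "slope_covered (p ^ k) (triangle t (t - 1) - {P}) (t - 1)" if "P \<in> triangle t (t - 1)" for P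
  proof -
    obtain a b where P: "P = (int a + int t * int b, int b)" and ab: "a + b \<le> t - 1"
      using \<open>P \<in> _\<close> by (auto simp: triangle_def)
    define Q where "Q i j = (int i + int t * int j, int j)" for i j :: nat
    have "\<exists>l. \<forall>j. on_line (p ^ k) l (Q i j)" for i
    proof -
      obtain l where "\<And>P. int t * snd P = 1 * fst P + - int i \<Longrightarrow> on_line (p ^ k) l P"
        using on_line_of_unit[OF assms(1) nt(1)] by blast
      then show ?thesis by (intro exI[of _ l]) (simp add: Q_def)
    qed
    then obtain v where v: "\<And>i j. on_line (p ^ k) (v i) (Q i j)" by metis
    have "\<exists>l. \<forall>i j. i + j = s \<longrightarrow> on_line (p ^ k) l (Q i j)" for s
    proof -
      obtain l where "\<And>P. (int t - 1) * snd P = 1 * fst P + - int s \<Longrightarrow> on_line (p ^ k) l P"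
        using on_line_of_unit[OF assms(1) nt(2)] by blast
      then show ?thesis by (intro exI[of _ l]) (auto simp: Q_def algebra_simps)
    qed
    then obtain d where d: "\<And>i j. on_line (p ^ k) (d (i + j)) (Q i j)" by metis
    have h: "on_line (p ^ k) (0, int j) (Q i j)" for i j by (simp add: on_line_def Q_def)
    \<comment> \<open>The columns left of \<open>(a, b)\<close>, the rows below it and the
      antidiagonals beyond it: at most \<open>t - 1\<close> lines. A grid point on none of them has
      \<open>i \<ge> a\<close>, \<open>j \<ge> b\<close> and \<open>i + j \<le> a + b\<close>, hence
      is the deleted point.\<close>
    define L where "L = v ` {..<a} \<union> (\<lambda>j. (0, int j)) ` {..<b} \<union> d ` {a + b<..t - 1}"
    have "card L \<le> card (v ` {..<a}) + card ((\<lambda>j. (0 :: int, int j)) ` {..<b}) + card (d ` {a + b<..t - 1})"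
      unfolding L_def by (meson card_Un_le le_trans add_le_mono1)
    also have "\<dots> \<le> a + b + (t - 1 - (a + b))"
      using card_image_le[of "{..<a}" v] card_image_le[of "{..<b}" "\<lambda>j. (0 :: int, int j)"]
        card_image_le[of "{a + b<..t - 1}" d] by simp
    finally have cL: "card L \<le> t - 1" using ab by simp
    have "\<exists>l\<in>L. on_line (p ^ k) l A" if A: "A \<in> triangle t (t - 1) - {P}" for A
    proof -
      obtain i j where ij: "A = Q i j" "i + j \<le> t - 1" using A by (auto simp: triangle_def Q_def)
      have "(i, j) \<noteq> (a, b)" using A ij(1) by (auto simp: P Q_def)
      then consider "i < a" | "j < b" | "a + b < i + j" by fastforce
      then show ?thesis
      proof cases
        case 1 then show ?thesis using v[of i j] ij by (auto simp: L_def)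
      next
        case 2 then show ?thesis using h[of j i] ij by (auto simp: L_def)
      next
        case 3 then have "d (i + j) \<in> L" using ij(2) by (auto simp: L_def)
        then show ?thesis using d[of i j] ij(1) by blast
      qed
    qed
    moreover have "finite L" by (simp add: L_def)
    ultimately show ?thesis unfolding slope_covered_def using cL by blast
  qed
  moreover have "finite (triangle t (t - 1))" unfolding triangle_def using finite_grid by (rule finite_imageI)
  ultimately show ?thesis
    unfolding critical_def using triangle_facts(1)[OF assms(1-3), of "t - 1"] nc assms(4) by simp
qed

section \<open>Transfer to the residue ring\<close>

definition residue_point :: "int \<Rightarrow> int \<times> int \<Rightarrow> int \<times> int" where
  "residue_point M P = (fst P mod M, snd P mod M)"

context residues
begin

lemma line_subset:
  assumes "a \<in> carrier R \<times> carrier R" "b \<in> carrier R \<times> carrier R"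
  shows "line R a b \<subseteq> carrier R \<times> carrier R"
  using assms unfolding line_def by auto

lemma finite_lines: "finite (lines R)"
proof (rule finite_subset)
  show "lines R \<subseteq> Pow (carrier R \<times> carrier R)"
    using line_subset unfolding lines_def by blast
  show "finite (Pow (carrier R \<times> carrier R))"
    by (simp add: res_carrier_eq)
qed

definition slope_line :: "int \<times> int \<Rightarrow> (int \<times> int) set" where
  "slope_line l = line R (0, snd l mod m) (1, fst l mod m)"

lemma slope_line_in_lines: "slope_line l \<in> lines R"
proof -
  have "(0, snd l mod m) \<in> carrier R \<times> carrier R" "(1, fst l mod m) \<in> carrier R \<times> carrier R"
    "fst (1, fst l mod m) \<in> Units R"
    using m_gt_one by (auto simp: res_carrier_eq res_units_eq)
  then show ?thesis unfolding slope_line_def lines_def by blast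
qed

lemma residue_point_on_slope_line:
  assumes "on_line m l P"
  shows "residue_point m P \<in> slope_line l"
proof -
  have "[snd P = snd l + fst P * fst l] (mod m)"
    using assms unfolding on_line_def cong_iff_dvd_diff by (simp add: algebra_simps)
  then have "snd P mod m = (snd l mod m + (fst P mod m * (fst l mod m)) mod m) mod m"
    by (simp add: cong_def mod_simps)
  moreover have "fst P mod m \<in> {0..m - 1}" using m_gt_one by simp
  ultimately show ?thesis
    unfolding slope_line_def line_def residue_point_def
    by (auto simp: res_carrier_eq res_add_eq res_mult_eq intro!: exI[of _ "fst P mod m"])
qed

text \<open>\<open>covered_by_lines\<close> asks for exactly \<open>n\<close> distinct lines, so a
  smaller cover has to be padded. The horizontal lines alone supply enough.\<close>

lemma card_lines_ge: "m \<le> int (card (lines R))"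
proof -
  have "inj_on (\<lambda>c. slope_line (0, c)) {0..<m}"
  proof (rule inj_onI)
    fix c d assume c: "c \<in> {0..<m}" and d: "d \<in> {0..<m}" and eq: "slope_line (0, c) = slope_line (0, d)"
    have "residue_point m (0, c) \<in> slope_line (0, c)"
      by (rule residue_point_on_slope_line) (simp add: on_line_def)
    then have "(0, c) \<in> slope_line (0, d)" using c eq by (simp add: residue_point_def)
    then show "c = d"
      using d by (auto simp: slope_line_def line_def res_add_eq res_mult_eq)
  qed
  moreover have "(\<lambda>c. slope_line (0, c)) ` {0..<m} \<subseteq> lines R"
    using slope_line_in_lines by blast
  ultimately have "card {0..<m} \<le> card (lines R)"
    using card_inj_on_le finite_lines by blast
  then show ?thesis by simp
qed

lemma covered_by_lines_if_slope_covered: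
  assumes "slope_covered m S n" "int n \<le> m"
  shows "covered_by_lines R (residue_point m ` S) n"
proof -
  obtain L where L: "finite L" "card L \<le> n" "\<forall>P\<in>S. \<exists>l\<in>L. on_line m l P"
    using assms(1) unfolding slope_covered_def by blast
  have "card (slope_line ` L) \<le> n" using card_image_le[OF L(1), of slope_line] L(2) by simp
  moreover have "n \<le> card (lines R)" using card_lines_ge assms(2) by simp
  moreover have "slope_line ` L \<subseteq> lines R" using slope_line_in_lines by blast
  ultimately obtain B where B: "slope_line ` L \<subseteq> B" "B \<subseteq> lines R" "card B = n"
    using exists_subset_between finite_lines by metis
  moreover have "residue_point m ` S \<subseteq> \<Union> B"
    using L(3) B(1) residue_point_on_slope_line by fastforce
  moreover have "finite B" using B(2) finite_lines finite_subset by blast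
  ultimately show ?thesis unfolding covered_by_lines_def by blast
qed

end

text \<open>If \<open>b2\<close> is a unit, then \<open>p ^ i\<close> divides \<open>d\<close>. Were
  \<open>p\<close> to divide \<open>b1\<close>, then \<open>p ^ Suc i\<close> would divide
  \<open>p ^ i * u\<close>, against the choice of \<open>u\<close>. So a line through two separated
  points has a unit horizontal component.\<close>

lemma separated_mod:
  assumes "prime p" "separated p k P Q"
    and "[fst P - fst Q = d * b1] (mod p ^ k)" "[snd P - snd Q = d * b2] (mod p ^ k)"
    and "coprime b2 (p ^ k)"
  shows "coprime b1 (p ^ k)"
proof (rule ccontr)
  assume nc: "\<not> coprime b1 (p ^ k)"
  obtain i u where i: "i < k" and u: "fst P - fst Q = p ^ i * u" "\<not> p dvd u"
    and w: "p ^ i dvd snd P - snd Q"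
    using assms(2) unfolding separated_def by blast
  have "p ^ Suc i dvd p ^ k" "p ^ i dvd p ^ k"
    using i by (simp_all add: le_imp_power_dvd Suc_leI del: power_Suc)
  then have d1: "p ^ Suc i dvd p ^ i * u - d * b1" and d2: "p ^ i dvd (snd P - snd Q) - d * b2"
    using assms(3,4) u(1) unfolding cong_iff_dvd_diff by (metis dvd_trans)+
  have "p dvd b1"
    using nc assms(1) by (metis coprime_commute coprime_power_left_iff prime_imp_coprime)
  have "p ^ i dvd d * b2" using d2 w by (metis dvd_diff_right_iff)
  moreover have "coprime (p ^ i) b2"
    using assms(5) i by (auto simp: coprime_commute)
  ultimately have "p ^ i dvd d" by (simp add: coprime_dvd_mult_left_iff)
  then have "p ^ Suc i dvd d * b1"
    using \<open>p dvd b1\<close> by (simp add: mult.commute mult_dvd_mono)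
  then have "p ^ Suc i dvd p ^ i * u" using d1 by (metis dvd_diff_left_iff)
  then have "p dvd u" using assms(1) by (auto simp: mult.commute[of p])
  then show False using u(2) by simp
qed

lemma inj_on_residue_point:
  assumes "prime p" "pairwise (separated p k) S"
  shows "inj_on (residue_point (p ^ k)) S"
proof (rule inj_onI, rule ccontr)
  fix P Q assume PQ: "P \<in> S" "Q \<in> S" "residue_point (p ^ k) P = residue_point (p ^ k) Q" "P \<noteq> Q"
  then have s: "separated p k P Q" using assms(2) unfolding pairwise_def by blast
  then have "k > 0" by (auto simp: separated_def)
  \<comment> \<open>Equal residues make both differences congruent to 0, which fits
    \<open>d = 0\<close> with direction \<open>(0, 1)\<close>.\<close>
  have "coprime 0 (p ^ k)"
    by (rule separated_mod[OF assms(1) s, of 0 0 1])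
      (use PQ(3) in \<open>auto simp: residue_point_def cong_iff_dvd_diff mod_eq_dvd_iff\<close>)
  then show False using assms(1) \<open>k > 0\<close> by (simp add: is_unit_power_iff not_prime_unit)
qed

text \<open>A line without unit horizontal component meets a separated set in at most one point, so it
  may be exchanged for a nonvertical one.\<close>

lemma slope_of_line:
  fixes p :: int
  assumes "prime p" "k > 0" "pairwise (separated p k) S" "X \<in> lines (residue_ring (p ^ k))"
  obtains l where "\<And>P. P \<in> S \<Longrightarrow> residue_point (p ^ k) P \<in> X \<Longrightarrow> on_line (p ^ k) l P"
proof -
  let ?M = "p ^ k" let ?R = "residue_ring ?M"
  have "1 < ?M" using prime_gt_1_int[OF assms(1)] assms(2) by (rule one_less_power)
  then interpret residues ?M ?R by unfold_locales
  obtain a1 a2 b1 b2 where X: "X = line ?R (a1, a2) (b1, b2)" and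
    b: "coprime b1 ?M \<or> coprime b2 ?M"
    using assms(4) unfolding lines_def by (auto simp: res_units_eq)
  have mem: "\<exists>s. [fst P = a1 + s * b1] (mod ?M) \<and> [snd P = a2 + s * b2] (mod ?M)"
    if "residue_point ?M P \<in> X" for P
    using that unfolding X line_def residue_point_def
    by (auto simp: res_add_eq res_mult_eq cong_def mod_simps)
  show ?thesis
  proof (cases "coprime b1 ?M")
    case True
    then obtain v where v: "[b1 * v = 1] (mod ?M)" using cong_solve_coprime_int by blast
    \<comment> \<open>The slope is \<open>b2 / b1\<close>, and the intercept makes the line pass
      through \<open>(a1, a2)\<close>.\<close>
    have "on_line ?M (v * b2, a2 - v * b2 * a1) P" if P: "residue_point ?M P \<in> X" for P
    proof -
      obtain s where s: "[fst P = a1 + s * b1] (mod ?M)" "[snd P = a2 + s * b2] (mod ?M)"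
        using mem[OF P] by blast
      have "[snd P - (v * b2) * fst P - (a2 - v * b2 * a1) =
          (a2 + s * b2) - (v * b2) * (a1 + s * b1) - (a2 - v * b2 * a1)] (mod ?M)"
        using s by (intro cong_diff cong_mult cong_refl)
      also have "(a2 + s * b2) - (v * b2) * (a1 + s * b1) - (a2 - v * b2 * a1) = s * b2 * (1 - b1 * v)"
        by (simp add: algebra_simps)
      also have "[s * b2 * (1 - b1 * v) = s * b2 * (1 - 1)] (mod ?M)"
        using v by (intro cong_diff cong_mult cong_refl)
      finally show ?thesis by (simp add: on_line_def cong_0_iff)
    qed
    then show ?thesis using that by blast
  next
    case False
    have uniq: "P = Q" if PQ: "P \<in> S" "Q \<in> S" "residue_point ?M P \<in> X" "residue_point ?M Q \<in> X" for P Q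
    proof (rule ccontr)
      assume "P \<noteq> Q"
      then have sep: "separated p k P Q" using assms(3) PQ unfolding pairwise_def by blast
      obtain s where s: "[fst P = a1 + s * b1] (mod ?M)" "[snd P = a2 + s * b2] (mod ?M)"
        using mem[OF PQ(3)] by blast
      obtain r where r: "[fst Q = a1 + r * b1] (mod ?M)" "[snd Q = a2 + r * b2] (mod ?M)"
        using mem[OF PQ(4)] by blast
      have "[fst P - fst Q = (s - r) * b1] (mod ?M)" "[snd P - snd Q = (s - r) * b2] (mod ?M)"
        using cong_diff[OF s(1) r(1)] cong_diff[OF s(2) r(2)] by (simp_all add: algebra_simps)
      then show False using separated_mod[OF assms(1) sep] b False by blast
    qed
    show ?thesis
    proof (cases "\<exists>P\<in>S. residue_point ?M P \<in> X")
      case True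
      then obtain P where P: "P \<in> S" "residue_point ?M P \<in> X" by blast
      \<comment> \<open>The horizontal line through the only point of \<open>S\<close> on
        \<open>X\<close> replaces \<open>X\<close>.\<close>
      have "on_line ?M (0, snd P) P" by (simp add: on_line_def)
      then show ?thesis using that[of "(0, snd P)"] uniq P by metis
    next
      case False
      then show ?thesis using that by blast
    qed
  qed
qed

lemma slope_covered_if_covered_by_lines:
  fixes p :: int
  assumes "prime p" "k > 0" "pairwise (separated p k) S"
    and "covered_by_lines (residue_ring (p ^ k)) (residue_point (p ^ k) ` S) n"
  shows "slope_covered (p ^ k) S n"
proof -
  obtain C where C: "C \<subseteq> lines (residue_ring (p ^ k))" "finite C" "card C = n"
    "residue_point (p ^ k) ` S \<subseteq> \<Union> C"
    using assms(4) unfolding covered_by_lines_def by blast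
  have "\<forall>X\<in>C. \<exists>l. \<forall>P\<in>S. residue_point (p ^ k) P \<in> X \<longrightarrow> on_line (p ^ k) l P"
    using slope_of_line[OF assms(1-3)] C(1) by (metis subsetD)
  then obtain f where f: "\<And>X P. X \<in> C \<Longrightarrow> P \<in> S \<Longrightarrow> residue_point (p ^ k) P \<in> X \<Longrightarrow> on_line (p ^ k) (f X) P"
    by metis
  have "\<exists>l\<in>f ` C. on_line (p ^ k) l P" if P: "P \<in> S" for P
  proof -
    obtain X where "X \<in> C" "residue_point (p ^ k) P \<in> X" using P C(4) by blast
    then show ?thesis using f P by blast
  qed
  then show ?thesis
    unfolding slope_covered_def using C(2,3) card_image_le[OF C(2), of f]
    by (intro exI[of _ "f ` C"]) auto
qed

text \<open>The triangle, critical modulo \<open>p ^ (k - m)\<close> for \<open>t - 1\<close> lines,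
  is doubled \<open>m = (k - 1) div 2\<close> times. This reaches modulus \<open>p ^ k\<close> and
  \<open>t - 1 + m = t'\<close> lines.\<close>

theorem theorem6:
  fixes p k t t' :: nat and R :: "int ring"
  assumes "prime p"
    and "3 \<le> k" and "k < p"
    and "2 \<le> t" and "real t < 1 / 4 * sqrt (real p)"
  defines "t' \<equiv> t + (k - 1) div 2 - 1"
    and "R \<equiv> residue_ring (int p ^ k)"
  shows "\<exists>S \<subseteq> carrier R \<times> carrier R.
    card S = 2 ^ ((k - 1) div 2) * (((t + 1) choose 2) + 1) - 1 \<and>
    \<not> covered_by_lines R S t' \<and>
    (\<forall>x\<in>S. covered_by_lines R (S - {x}) t')"
proof -
  define m where "m = (k - 1) div 2"
  define P where "P = int p"
  have P: "prime P" using assms(1) by (simp add: P_def)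
  have m: "k - m > 0" "k - m + m = k" "2 * m < p"
    using assms(2,3) unfolding m_def by linarith+
  have "(4 * real t)\<^sup>2 < (sqrt (real p))\<^sup>2"
    using assms(5) by (intro power_strict_mono) auto
  then have "real (16 * (t * t)) < real p" by (simp add: power2_eq_square)
  \<comment> \<open>Together with \<open>2 * m < p\<close> this leaves room for the residues of the
    triangle and the \<open>m\<close> new ones, and it bounds \<open>t'\<close> by \<open>p\<close>
    for the padding.\<close>
  then have tt: "16 * (t * t) < p" by (simp only: of_nat_less_iff)
  have choose: "(t + 1) choose 2 \<le> t * t"
  proof -
    have "t \<le> t * t" by simp
    then show ?thesis
      using div_le_mono[of "t + t * t" "2 * (t * t)" 2] by (simp add: choose_two algebra_simps)
  qed
  have t1: "t - 1 + 2 = t + 1" using assms(4) by simp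
  have ttP: "int t * int t < P"
  proof -
    have "int (t * t) < P" unfolding P_def using tt by linarith
    then show ?thesis by simp
  qed
  note base = critical_triangle[OF P ttP m(1) assms(4)]
  have card_base: "card (triangle t (t - 1)) = (t + 1) choose 2"
    using triangle_facts(2)[OF P ttP m(1), of "t - 1"] assms(4) t1 by simp
  have "card (triangle t (t - 1)) + m \<le> nat P"
    unfolding card_base P_def using choose tt m(3) by simp
  from critical_iterate[OF P base m(1) this]
  obtain S where S: "critical P k (t - 1 + m) S"
    "card S + 1 = 2 ^ m * (((t + 1) choose 2) + 1)"
    unfolding card_base m(2) by blast
  have t': "t - 1 + m = t'" using assms(4) unfolding t'_def m_def by simp
  have sep: "pairwise (separated P k) S" and not: "\<not> slope_covered (P ^ k) S t'"
    and crit: "\<And>A. A \<in> S \<Longrightarrow> slope_covered (P ^ k) (S - {A}) t'"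
    using S(1) unfolding critical_def t' by auto
  have k: "k > 0" using assms(2) by simp
  have P1: "1 < P ^ k" using P k by (simp add: prime_gt_1_int)
  interpret residues "P ^ k" R
    unfolding R_def P_def[symmetric] using P1 by unfold_locales
  have R: "R = residue_ring (P ^ k)" by (simp add: R_def P_def)
  let ?r = "residue_point (P ^ k)"
  have inj: "inj_on ?r S" using inj_on_residue_point[OF P sep] .
  have tM: "int t' \<le> P ^ k"
  proof -
    have "t \<le> t * t" by simp
    then have "int t' \<le> P" using t' tt m(3) unfolding P_def by linarith
    also have "P \<le> P ^ k" using P k by (simp add: self_le_power prime_ge_1_int)
    finally show ?thesis .
  qed
  show ?thesis
  proof (intro exI[of _ "?r ` S"] conjI ballI)
    show "?r ` S \<subseteq> carrier R \<times> carrier R"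
      using P1 by (auto simp: residue_point_def res_carrier_eq)
    show "card (?r ` S) = 2 ^ ((k - 1) div 2) * (((t + 1) choose 2) + 1) - 1"
      using S(2) card_image[OF inj] unfolding m_def by simp
    show "\<not> covered_by_lines R (?r ` S) t'"
      using slope_covered_if_covered_by_lines[OF P k sep] not unfolding R by blast
    fix x assume "x \<in> ?r ` S"
    then obtain A where A: "A \<in> S" "x = ?r A" by blast
    have "?r ` S - {x} = ?r ` (S - {A})"
      using inj_on_image_set_diff[OF inj, of S "{A}"] A by simp
    then show "covered_by_lines R (?r ` S - {x}) t'"
      using covered_by_lines_if_slope_covered[OF crit[OF A(1)] tM] by simp
  qed
qed

end
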